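(* Let $G \leqslant \mathrm{Sym}(\Omega)$ be a semiprimitive permutation group (with $\Omega$ a possibly infinite set) and let $K$ be a plinth of $G$. (1) If $K$ is non-regular, then $K$ is perfect and $K$ is the unique plinth of $G$. (2) If $L$ is another plinth of $G$ (that is, $L \neq K$), then $K/(L\cap K) \cong L/(L\cap K)$ is characteristically simple, and every plinth of $G$ is contained in $KL$.
   Context: A permutation group on a set $\Omega$ is semiregular if all its point-stabilisers are trivial, and regular if it is semiregular and transitive. A transitive permutation group $G$ is semiprimitive if every normal subgroup of $G$ is transitive or semiregular. A plinth of a transitive permutation group $G$ is a minimally transitive normal subgroup: a transitive normal subgroup $K$ of $G$ such that no proper subgroup of $K$ that is normal in $G$ is transitive. A group is perfect if it equals its commutator subgroup. *)

theory Defs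
  imports "HOL-Algebra.Algebra"
begin

text \<open>Permutations of \<open>\<Omega>\<close> are the elements of \<^const>\<open>BijGroup\<close>, that is, bijections of \<open>\<Omega>\<close>
  extended by \<^const>\<open>undefined\<close> outside \<open>\<Omega>\<close>. A permutation group is a subgroup of
  \<^const>\<open>BijGroup\<close> \<open>\<Omega>\<close>, represented by its carrier set; its action on \<open>\<Omega>\<close> is \<open>\<lambda>g. g\<close>.\<close>

abbreviation perm_group :: "'a set \<Rightarrow> ('a \<Rightarrow> 'a) set \<Rightarrow> ('a \<Rightarrow> 'a) monoid"
  where "perm_group \<Omega> H \<equiv> (BijGroup \<Omega>)\<lparr>carrier := H\<rparr>"

abbreviation transitive_on :: "'a set \<Rightarrow> ('a \<Rightarrow> 'a) set \<Rightarrow> bool"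
  where "transitive_on \<Omega> H \<equiv> transitive_action (perm_group \<Omega> H) \<Omega> (\<lambda>g. g)"

definition semiregular :: "'a set \<Rightarrow> ('a \<Rightarrow> 'a) set \<Rightarrow> bool"
  where "semiregular \<Omega> H \<longleftrightarrow>
    subgroup H (BijGroup \<Omega>) \<and>
    (\<forall>x\<in>\<Omega>. stabilizer (perm_group \<Omega> H) (\<lambda>g. g) x = {\<one>\<^bsub>BijGroup \<Omega>\<^esub>})"

definition regular :: "'a set \<Rightarrow> ('a \<Rightarrow> 'a) set \<Rightarrow> bool"
  where "regular \<Omega> H \<longleftrightarrow> semiregular \<Omega> H \<and> transitive_on \<Omega> H"

definition semiprimitive :: "'a set \<Rightarrow> ('a \<Rightarrow> 'a) set \<Rightarrow> bool"
  where "semiprimitive \<Omega> G \<longleftrightarrow>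
    transitive_on \<Omega> G \<and>
    (\<forall>N. N \<lhd> perm_group \<Omega> G \<longrightarrow> transitive_on \<Omega> N \<or> semiregular \<Omega> N)"

definition plinth :: "'a set \<Rightarrow> ('a \<Rightarrow> 'a) set \<Rightarrow> ('a \<Rightarrow> 'a) set \<Rightarrow> bool"
  where "plinth \<Omega> G K \<longleftrightarrow>
    K \<lhd> perm_group \<Omega> G \<and> transitive_on \<Omega> K \<and>
    (\<forall>M. M \<subset> K \<longrightarrow> M \<lhd> perm_group \<Omega> G \<longrightarrow> \<not> transitive_on \<Omega> M)"

definition perfect_group :: "('a, 'b) monoid_scheme \<Rightarrow> bool"
  where "perfect_group G \<longleftrightarrow> group G \<and> derived G (carrier G) = carrier G"

definition characteristic_subgroup :: "'a set \<Rightarrow> ('a, 'b) monoid_scheme \<Rightarrow> bool"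
  where "characteristic_subgroup H G \<longleftrightarrow> subgroup H G \<and> (\<forall>\<phi>\<in>iso G G. \<phi> ` H = H)"

text \<open>The trivial group is not regarded as characteristically simple.\<close>

definition characteristically_simple :: "('a, 'b) monoid_scheme \<Rightarrow> bool"
  where "characteristically_simple G \<longleftrightarrow>
    group G \<and> carrier G \<noteq> {\<one>\<^bsub>G\<^esub>} \<and>
    (\<forall>H. characteristic_subgroup H G \<longrightarrow> H = {\<one>\<^bsub>G\<^esub>} \<or> H = carrier G)"

end

theory Submission
  imports Defs
begin

text \<open>
  If \<open>N\<close> is an intransitive normal subgroup of \<open>G\<close>, then the kernel of \<open>G\<close> on the set of
  \<open>N\<close>-orbits is normal and intransitive, hence semiregular. So if \<open>K\<close> commutes modulo \<open>N\<close> with a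
  transitive subgroup, then \<open>K\<close> is semiregular: a point stabiliser in \<open>K\<close> lies in that kernel.
  The choices \<open>N = K'\<close> and \<open>N = K \<inter> L\<close> give (1), and \<open>N = P \<inter> K L\<close> shows
  \<open>P \<subseteq> K L\<close>, as otherwise \<open>K L\<close> would be semiregular with the transitive subgroups \<open>K\<close> and \<open>L\<close>.
  For distinct plinths \<open>K\<close> and \<open>L\<close>, both regular, sending \<open>k\<close> to the \<open>l \<in> L\<close> with \<open>l (k a) = a\<close>
  induces the isomorphism of the quotients. Finally, if \<open>H\<close> is normal in \<open>G\<close> with
  \<open>K \<inter> L \<subseteq> H \<subset> K\<close>, then for \<open>h \<in> H\<close> and \<open>l \<in> L\<close> with \<open>l (h a) = a\<close> the product \<open>l h\<close> fixes
  every \<open>H\<close>-orbit and the point \<open>a\<close>, so \<open>h \<in> K \<inter> L\<close>.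
\<close>

section \<open>Transitivity and semiregularity of permutation groups, pointwise\<close>

lemma subgroup_BijGroup_action:
  assumes "subgroup H (BijGroup \<Omega>)"
  shows "group_action (perm_group \<Omega> H) \<Omega> (\<lambda>g. g)"
proof -
  have "group (perm_group \<Omega> H)"
    using assms group_BijGroup by (rule subgroup.subgroup_is_group)
  then show ?thesis
    using group_BijGroup subgroup.mem_carrier[OF assms]
    by (intro group_action.intro group_hom.intro group_hom_axioms.intro homI) auto
qed

lemma transitive_on_iff:
  assumes "subgroup H (BijGroup \<Omega>)"
  shows "transitive_on \<Omega> H \<longleftrightarrow> (\<forall>x\<in>\<Omega>. \<forall>y\<in>\<Omega>. \<exists>g\<in>H. g x = y)"
  using subgroup_BijGroup_action[OF assms]
  by (auto simp: transitive_action_def transitive_action_axioms_def)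

lemma semiregular_iff:
  assumes "subgroup H (BijGroup \<Omega>)"
  shows "semiregular \<Omega> H \<longleftrightarrow> (\<forall>x\<in>\<Omega>. \<forall>g\<in>H. g x = x \<longrightarrow> g = \<one>\<^bsub>BijGroup \<Omega>\<^esub>)"
proof -
  have "\<one>\<^bsub>BijGroup \<Omega>\<^esub> x = x" if "x \<in> \<Omega>" for x
    using that by (simp add: BijGroup_def)
  then show ?thesis
    using assms subgroup.one_closed[OF assms] by (auto simp: semiregular_def stabilizer_def)
qed

section \<open>Commutators, products and conjugation for normal subgroups\<close>

lemma (in group) normal_conj_closed:
  assumes "N \<lhd> G" "g \<in> carrier G" "n \<in> N"
  shows "g \<otimes> n \<otimes> inv g \<in> N" "inv g \<otimes> n \<otimes> g \<in> N"
  using normal.inv_op_closed1[OF assms] normal.inv_op_closed2[OF assms] by auto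

lemma (in group) inv_mult_cancel:
  assumes "x \<in> carrier G" "y \<in> carrier G"
  shows "inv x \<otimes> (x \<otimes> y) = y" "x \<otimes> (inv x \<otimes> y) = y"
  using assms by (simp_all flip: m_assoc)

text \<open>Bracketed one way, the commutator is \<open>k\<close> times a conjugate of
  \<open>inv k\<close>; bracketed the other way, a conjugate of \<open>l\<close> times
  \<open>inv l\<close>. Thus normal subgroups commute modulo their intersection.\<close>

lemma (in group) commutator_in_normal_Int:
  assumes "K \<lhd> G" "L \<lhd> G" "k \<in> K" "l \<in> L"
  shows "k \<otimes> l \<otimes> inv k \<otimes> inv l \<in> K \<inter> L"
proof
  have subs: "subgroup K G" "subgroup L G"
    using assms normal_imp_subgroup by auto
  have mem: "k \<in> carrier G" "l \<in> carrier G"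
    using assms subs by (auto dest: subgroup.mem_carrier)
  have "k \<otimes> (l \<otimes> inv k \<otimes> inv l) \<in> K"
    using assms subs mem by (intro subgroup.m_closed normal_conj_closed subgroup.m_inv_closed) auto
  then show "k \<otimes> l \<otimes> inv k \<otimes> inv l \<in> K"
    using mem by (simp add: m_assoc)
  show "k \<otimes> l \<otimes> inv k \<otimes> inv l \<in> L"
    using assms subs mem by (intro subgroup.m_closed normal_conj_closed subgroup.m_inv_closed) auto
qed

lemma (in group) set_mult_normal:
  assumes "K \<lhd> G" "L \<lhd> G"
  shows "K <#> L \<lhd> G"
proof -
  have subs: "subgroup K G" "subgroup L G"
    using assms normal_imp_subgroup by auto
  then have sub: "subgroup (K <#> L) G"
    using assms(1) second_isomorphism_grp.normal_set_mult_subgroup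
    by (auto simp: second_isomorphism_grp_def second_isomorphism_grp_axioms_def)
  show ?thesis
    unfolding normal_inv_iff
  proof (intro conjI sub ballI)
    fix g x assume g: "g \<in> carrier G" and "x \<in> K <#> L"
    then obtain k l where x: "x = k \<otimes> l" "k \<in> K" "l \<in> L"
      by (auto simp: set_mult_def)
    have mem: "k \<in> carrier G" "l \<in> carrier G"
      using x subs by (auto dest: subgroup.mem_carrier)
    have "g \<otimes> x \<otimes> inv g = (g \<otimes> k \<otimes> inv g) \<otimes> (g \<otimes> l \<otimes> inv g)"
      using g mem by (simp add: x m_assoc inv_solve_left)
    then show "g \<otimes> x \<otimes> inv g \<in> K <#> L"
      using normal_conj_closed(1)[OF assms(1) g x(2)] normal_conj_closed(1)[OF assms(2) g x(3)]
      by (auto simp: set_mult_def)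
  qed
qed

lemma (in group) conj_hom:
  assumes "g \<in> carrier G"
  shows "(\<lambda>x. g \<otimes> x \<otimes> inv g) \<in> hom G G"
  using assms by (auto simp: hom_def m_assoc inv_solve_left)

lemma (in group) conj_inv_conj:
  assumes "g \<in> carrier G" "x \<in> carrier G"
  shows "g \<otimes> (inv g \<otimes> x \<otimes> inv (inv g)) \<otimes> inv g = x"
  using assms by (simp add: m_assoc flip: m_assoc[of g "inv g"])

lemma (in group) conj_coset:
  assumes "N \<lhd> G" "g \<in> carrier G" "k \<in> carrier G"
  shows "(\<lambda>x. g \<otimes> x \<otimes> inv g) ` (N #> k) = N #> (g \<otimes> k \<otimes> inv g)"
proof -
  let ?c = "\<lambda>x. g \<otimes> x \<otimes> inv g"
  interpret N: normal N G by fact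
  have "?c ` N = N"
  proof
    show "?c ` N \<subseteq> N"
      using normal_conj_closed assms by auto
    show "N \<subseteq> ?c ` N"
    proof
      fix n assume "n \<in> N"
      then have "n = ?c (inv g \<otimes> n \<otimes> inv (inv g))" "inv g \<otimes> n \<otimes> inv (inv g) \<in> N"
        using conj_inv_conj[of g n] normal_conj_closed(1)[OF assms(1), of "inv g" n] assms(2)
        by auto
      then show "n \<in> ?c ` N"
        by blast
    qed
  qed
  then show ?thesis
    using set_mult_hom[OF conj_hom[OF assms(2)] N.subset, of "{k}"] assms(3)
    by (simp add: r_coset_eq_set_mult)
qed

text \<open>A characteristic subgroup of the quotient is stable under these automorphisms, so its
  preimage in \<open>K\<close> will be normal in \<open>G\<close> and not only in \<open>K\<close>.
  The inverse map is induced by conjugation with \<open>inv g\<close>.\<close>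

lemma (in group) conj_iso_FactGroup:
  assumes "K \<lhd> G" "N \<lhd> G" "g \<in> carrier G"
  shows "image (\<lambda>x. g \<otimes> x \<otimes> inv g) \<in> iso (G\<lparr>carrier := K\<rparr> Mod N) (G\<lparr>carrier := K\<rparr> Mod N)"
proof -
  let ?Q = "G\<lparr>carrier := K\<rparr> Mod N"
  let ?c = "\<lambda>g x. g \<otimes> x \<otimes> inv g"
  interpret N: normal N G by fact
  have KG: "K \<subseteq> carrier G"
    using assms(1) by (meson normal_imp_subgroup subgroup.subset)
  have sub: "A \<subseteq> carrier G" if "A \<in> carrier ?Q" for A
    using that KG r_coset_subset_G[OF N.subset] by (auto simp: carrier_FactGroup)
  have img: "?c g ` A \<in> carrier ?Q" if "g \<in> carrier G" "A \<in> carrier ?Q" for g A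
  proof -
    obtain k where "k \<in> K" "A = N #> k"
      using \<open>A \<in> carrier ?Q\<close> by (auto simp: carrier_FactGroup)
    then show ?thesis
      using \<open>g \<in> carrier G\<close> normal_conj_closed(1)[OF assms(1)] conj_coset[OF assms(2)] KG
      by (auto simp: carrier_FactGroup)
  qed
  have inv: "?c g ` ?c (inv g) ` A = A" if "g \<in> carrier G" "A \<in> carrier ?Q" for g A
  proof -
    have "?c g (?c (inv g) x) = x" if "x \<in> A" for x
      using conj_inv_conj[OF \<open>g \<in> carrier G\<close>] sub[OF \<open>A \<in> carrier ?Q\<close>] that by blast
    then show ?thesis
      unfolding image_image by (simp cong: image_cong_simp)
  qed
  have "image (?c g) \<in> hom ?Q ?Q"
    using img assms(3) sub set_mult_hom[OF conj_hom[OF assms(3)]] by (auto simp: hom_def)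
  moreover have "bij_betw (image (?c g)) (carrier ?Q) (carrier ?Q)"
    by (rule bij_betw_byWitness[where f' = "image (?c (inv g))"])
      (use img[of g] img[of "inv g"] inv[of g] inv[of "inv g"] assms(3) in auto)
  ultimately show ?thesis
    by (simp add: iso_def)
qed

section \<open>Semiprimitive groups, their action and their orbit kernels\<close>

locale semiprimitive_group =
  fixes \<Omega> :: "'a set" and S and G (structure)
  assumes subgroup_BijGroup: "subgroup S (BijGroup \<Omega>)"
    and semiprimitive: "semiprimitive \<Omega> S"
    and G_eq: "G = perm_group \<Omega> S"
begin

lemma carrier_G [simp]: "carrier G = S"
  by (simp add: G_eq)

sublocale group G
  unfolding G_eq using subgroup_BijGroup group_BijGroup by (rule subgroup.subgroup_is_group)

sublocale action: group_action G \<Omega> "\<lambda>g. g"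
  unfolding G_eq using subgroup_BijGroup by (rule subgroup_BijGroup_action)

text \<open>\<open>carrier_G\<close> turns goals into membership in \<open>S\<close>, where the
  closure rules for \<open>carrier G\<close> no longer match.\<close>

lemma S_closed [simp]:
  "g \<in> S \<Longrightarrow> h \<in> S \<Longrightarrow> g \<otimes> h \<in> S" "g \<in> S \<Longrightarrow> inv g \<in> S"
  using m_closed inv_closed by simp_all

lemma subgroup_imp_BijGroup:
  assumes "subgroup H G"
  shows "subgroup H (BijGroup \<Omega>)"
  using group.incl_subgroup[OF group_BijGroup subgroup_BijGroup] assms by (simp add: G_eq)

lemma transitive_on_iff:
  "subgroup H G \<Longrightarrow> transitive_on \<Omega> H \<longleftrightarrow> (\<forall>x\<in>\<Omega>. \<forall>y\<in>\<Omega>. \<exists>g\<in>H. g x = y)"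
  by (intro transitive_on_iff subgroup_imp_BijGroup)

lemma semiregular_iff:
  "subgroup H G \<Longrightarrow> semiregular \<Omega> H \<longleftrightarrow> (\<forall>x\<in>\<Omega>. \<forall>g\<in>H. g x = x \<longrightarrow> g = \<one>)"
  using semiregular_iff[OF subgroup_imp_BijGroup] by (simp add: G_eq)

lemma mult_apply: "g \<in> S \<Longrightarrow> h \<in> S \<Longrightarrow> x \<in> \<Omega> \<Longrightarrow> (g \<otimes> h) x = g (h x)"
  using action.composition_rule by simp

lemma apply_mem: "g \<in> S \<Longrightarrow> x \<in> \<Omega> \<Longrightarrow> g x \<in> \<Omega>"
  by (rule action.element_image[OF _ _ refl]) simp_all

lemma inv_apply_apply: "g \<in> S \<Longrightarrow> x \<in> \<Omega> \<Longrightarrow> (inv g) (g x) = x"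
  by (rule action.orbit_sym_aux) simp_all

lemma apply_inv_apply: "g \<in> S \<Longrightarrow> x \<in> \<Omega> \<Longrightarrow> g ((inv g) x) = x"
  using inv_apply_apply[of "inv g" x] inv_closed[of g] by simp

lemma normal_transitive_or_semiregular:
  "N \<lhd> G \<Longrightarrow> transitive_on \<Omega> N \<or> semiregular \<Omega> N"
  using semiprimitive by (simp add: semiprimitive_def G_eq)

lemma semiregular_eqI:
  assumes "subgroup H G" "semiregular \<Omega> H" "g \<in> H" "h \<in> H" "x \<in> \<Omega>" "g x = h x"
  shows "g = h"
proof -
  have S: "g \<in> S" "h \<in> S" "inv h \<in> S"
    using subgroup.mem_carrier[OF assms(1)] assms(3,4) inv_closed[of h] by simp_all
  have "(inv h \<otimes> g) x = x"
    using S assms(5,6) by (simp add: mult_apply inv_apply_apply)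
  then have "inv h \<otimes> g = \<one>"
    using assms subgroup.m_closed subgroup.m_inv_closed by (metis semiregular_iff)
  then show ?thesis
    using S by (metis carrier_G inv_closed inv_equality inv_inv)
qed

text \<open>Some element of \<open>H\<close> agrees with a given \<open>m\<close> in
  \<open>M\<close> at one point, and in the semiregular \<open>M\<close> this forces
  equality.\<close>

lemma transitive_subset_semiregular:
  assumes "subgroup M G" "semiregular \<Omega> M" "subgroup H G" "H \<subseteq> M" "transitive_on \<Omega> H" "\<Omega> \<noteq> {}"
  shows "H = M"
proof
  show "M \<subseteq> H"
  proof
    fix m assume m: "m \<in> M"
    obtain x where x: "x \<in> \<Omega>"
      using assms(6) by blast
    have "m x \<in> \<Omega>"
      using apply_mem x m subgroup.mem_carrier[OF assms(1)] by simp
    then obtain h where "h \<in> H" "h x = m x"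
      using assms(3,5) x by (auto simp: transitive_on_iff)
    then show "m \<in> H"
      using semiregular_eqI[OF assms(1,2) _ m x] assms(4) by blast
  qed
qed (fact assms(4))

text \<open>The element \<open>n\<close> may depend on \<open>x\<close>. For normal \<open>N\<close>
  this is the kernel of the action on the set of \<open>N\<close>-orbits, written without forming
  that set.\<close>

definition orbit_kernel :: "('a \<Rightarrow> 'a) set \<Rightarrow> ('a \<Rightarrow> 'a) set"
  where "orbit_kernel N = {g \<in> S. \<forall>x\<in>\<Omega>. \<exists>n\<in>N. g x = n x}"

lemma orbit_kernel_normal:
  assumes "N \<lhd> G"
  shows "orbit_kernel N \<lhd> G"
proof -
  interpret N: normal N G by fact
  have NS: "n \<in> S" if "n \<in> N" for n
    using N.mem_carrier that by simp
  have iS: "inv g \<in> S" if "g \<in> S" for g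
    using inv_closed that by simp
  have mS: "g \<otimes> h \<in> S" if "g \<in> S" "h \<in> S" for g h
    using m_closed that by simp
  have "subgroup (orbit_kernel N) G"
  proof (rule subgroupI)
    show "orbit_kernel N \<subseteq> carrier G"
      by (auto simp: orbit_kernel_def)
    have "\<one> \<in> orbit_kernel N"
      using N.one_closed NS by (auto simp: orbit_kernel_def)
    then show "orbit_kernel N \<noteq> {}"
      by blast
  next
    fix g assume g: "g \<in> orbit_kernel N"
    then have gS: "g \<in> S"
      by (simp add: orbit_kernel_def)
    have "\<exists>n\<in>N. (inv g) x = n x" if x: "x \<in> \<Omega>" for x
    proof -
      have y: "(inv g) x \<in> \<Omega>"
        using apply_mem[OF iS[OF gS] x] .
      obtain n where n: "n \<in> N" "g ((inv g) x) = n ((inv g) x)"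
        using g y by (auto simp: orbit_kernel_def)
      then have "x = n ((inv g) x)"
        using apply_inv_apply[OF gS x] by simp
      then have "(inv n) x = (inv g) x"
        using inv_apply_apply[OF NS[OF n(1)] y] by simp
      then show ?thesis
        using n(1) by (metis N.m_inv_closed)
    qed
    then show "inv g \<in> orbit_kernel N"
      using iS[OF gS] by (simp add: orbit_kernel_def)
  next
    fix g h assume g: "g \<in> orbit_kernel N" and h: "h \<in> orbit_kernel N"
    have "\<exists>n\<in>N. (g \<otimes> h) x = n x" if x: "x \<in> \<Omega>" for x
    proof -
      obtain n where n: "n \<in> N" "h x = n x"
        using h x by (auto simp: orbit_kernel_def)
      \<comment> \<open>The element for \<open>g\<close> is taken at \<open>n x\<close>, where
        \<open>h\<close> has sent \<open>x\<close>, so that the two can be multiplied.\<close>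
      obtain m where m: "m \<in> N" "g (n x) = m (n x)"
        using g apply_mem[OF NS[OF n(1)] x] by (auto simp: orbit_kernel_def)
      have "(g \<otimes> h) x = (m \<otimes> n) x"
        using g h n m x NS by (simp add: mult_apply orbit_kernel_def)
      then show ?thesis
        using n m by blast
    qed
    then show "g \<otimes> h \<in> orbit_kernel N"
      using g h mS by (simp add: orbit_kernel_def)
  qed
  moreover have "h \<otimes> g \<otimes> inv h \<in> orbit_kernel N" if h: "h \<in> S" and g: "g \<in> orbit_kernel N" for g h
  proof -
    have gS: "g \<in> S"
      using g by (simp add: orbit_kernel_def)
    have "\<exists>n\<in>N. (h \<otimes> g \<otimes> inv h) x = n x" if x: "x \<in> \<Omega>" for x
    proof -
      have y: "(inv h) x \<in> \<Omega>"
        using apply_mem[OF iS[OF h] x] .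
      obtain n where n: "n \<in> N" "g ((inv h) x) = n ((inv h) x)"
        using g y by (auto simp: orbit_kernel_def)
      have "(h \<otimes> g \<otimes> inv h) x = (h \<otimes> n \<otimes> inv h) x"
        using n h gS NS iS mS x y by (simp add: mult_apply)
      then show ?thesis
        using normal_conj_closed(1)[OF assms _ n(1)] h by auto
    qed
    then show ?thesis
      using h gS iS mS by (simp add: orbit_kernel_def)
  qed
  ultimately show ?thesis
    by (auto simp: normal_inv_iff)
qed

text \<open>The orbits of the kernel lie inside those of \<open>N\<close>, so it is intransitive
  like \<open>N\<close>; being normal, it is then semiregular. This is where semiprimitivity enters
  the proof.\<close>

lemma orbit_kernel_fixed_point:
  assumes "N \<lhd> G" "\<not> transitive_on \<Omega> N" "g \<in> orbit_kernel N" "x \<in> \<Omega>" "g x = x"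
  shows "g = \<one>"
proof -
  note normal = orbit_kernel_normal[OF assms(1)]
  note sub = normal_imp_subgroup[OF normal] normal_imp_subgroup[OF assms(1)]
  have "\<not> transitive_on \<Omega> (orbit_kernel N)"
    using assms(2) sub by (simp add: transitive_on_iff) (force simp: orbit_kernel_def)
  then have "semiregular \<Omega> (orbit_kernel N)"
    using normal_transitive_or_semiregular normal by blast
  then show ?thesis
    using assms sub by (simp add: semiregular_iff)
qed

text \<open>A permutation commuting modulo \<open>N\<close> with a transitive group and fixing a point
  fixes every \<open>N\<close>-orbit.\<close>

lemma commutator_imp_semiregular:
  assumes "N \<lhd> G" "\<not> transitive_on \<Omega> N" "subgroup K G" "subgroup L G" "transitive_on \<Omega> L"
    and comm: "\<And>k l. k \<in> K \<Longrightarrow> l \<in> L \<Longrightarrow> k \<otimes> l \<otimes> inv k \<otimes> inv l \<in> N"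
  shows "semiregular \<Omega> K"
  unfolding semiregular_iff[OF assms(3)]
proof (intro ballI impI)
  fix x k assume x: "x \<in> \<Omega>" and k: "k \<in> K" and kx: "k x = x"
  have kS: "k \<in> S"
    using k subgroup.mem_carrier[OF assms(3)] by simp
  have "\<exists>n\<in>N. k y = n y" if y: "y \<in> \<Omega>" for y
  proof -
    obtain l where l: "l \<in> L" "l x = y"
      using assms(4,5) x y by (auto simp: transitive_on_iff)
    have lS: "l \<in> S"
      using l subgroup.mem_carrier[OF assms(4)] by simp
    let ?n = "k \<otimes> l \<otimes> inv k \<otimes> inv l"
    have nS: "?n \<in> S"
      using kS lS m_closed inv_closed by simp
    have "k y = (k \<otimes> l) x"
      using kS lS l x by (simp add: mult_apply)
    \<comment> \<open>Exchanging \<open>k\<close> and \<open>l\<close> costs a commutator in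
      \<open>N\<close>; \<open>k\<close> then acts first and fixes \<open>x\<close>, so
      \<open>k\<close> moves \<open>y = l x\<close> within its \<open>N\<close>-orbit.\<close>
    also have "k \<otimes> l = ?n \<otimes> (l \<otimes> k)"
      using kS lS by (simp add: m_assoc inv_mult_cancel)
    also have "\<dots> x = ?n (l (k x))"
      using nS kS lS x m_closed[of l k] by (simp add: mult_apply)
    finally show ?thesis
      using kx l comm[OF k l(1)] by auto
  qed
  then show "k = \<one>"
    using orbit_kernel_fixed_point[of N k x, OF assms(1,2) _ x kx] kS by (simp add: orbit_kernel_def)
qed

section \<open>Plinths: semiregularity, perfectness, containment in products\<close>

lemma plinthD:
  assumes "plinth \<Omega> S K"
  shows "K \<lhd> G" "transitive_on \<Omega> K" "subgroup K G"
    and "\<And>M. M \<lhd> G \<Longrightarrow> M \<subseteq> K \<Longrightarrow> transitive_on \<Omega> M \<Longrightarrow> M = K"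
proof -
  show K: "K \<lhd> G" and "transitive_on \<Omega> K"
    using assms by (simp_all add: plinth_def G_eq)
  show "subgroup K G"
    using K by (rule normal_imp_subgroup)
  show "M = K" if "M \<lhd> G" "M \<subseteq> K" "transitive_on \<Omega> M" for M
  proof -
    have "\<forall>M\<subset>K. M \<lhd> G \<longrightarrow> \<not> transitive_on \<Omega> M"
      using assms by (simp add: plinth_def G_eq)
    then have "\<not> M \<subset> K"
      using that(1,3) by (intro notI) simp
    then show ?thesis
      using that(2) by blast
  qed
qed

text \<open>A transitive intersection would equal both \<open>K\<close> and \<open>L\<close> by
  their minimality.\<close>

lemma plinth_Int:
  assumes "plinth \<Omega> S K" "plinth \<Omega> S L" "L \<noteq> K"
  shows "L \<inter> K \<lhd> G" "\<not> transitive_on \<Omega> (L \<inter> K)"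
proof -
  show normal: "L \<inter> K \<lhd> G"
    using normal_subgroup_intersect[OF plinthD(1)[OF assms(2)] plinthD(1)[OF assms(1)]] .
  show "\<not> transitive_on \<Omega> (L \<inter> K)"
  proof
    assume trans: "transitive_on \<Omega> (L \<inter> K)"
    show False
      using plinthD(4)[OF assms(1) normal inf_le2 trans] plinthD(4)[OF assms(2) normal inf_le1 trans]
        assms(3) by metis
  qed
qed

text \<open>\<open>K\<close> and the transitive \<open>L\<close> commute modulo their intransitive
  intersection. The contrapositive is the uniqueness of a non-regular plinth.\<close>

lemma plinth_semiregular:
  assumes "plinth \<Omega> S K" "plinth \<Omega> S L" "L \<noteq> K"
  shows "semiregular \<Omega> K"
  using commutator_imp_semiregular[OF plinth_Int[OF assms] plinthD(3)[OF assms(1)]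
      plinthD(3,2)[OF assms(2)]]
    commutator_in_normal_Int[OF plinthD(1)[OF assms(1)] plinthD(1)[OF assms(2)]]
  by (simp add: Int_commute)

text \<open>\<open>K\<close> commutes with itself modulo its derived subgroup. Were the latter
  intransitive, \<open>K\<close> would be semiregular; so it is transitive, and minimality gives
  equality.\<close>

lemma plinth_perfect:
  assumes "plinth \<Omega> S K" "\<not> semiregular \<Omega> K"
  shows "perfect_group (G\<lparr>carrier := K\<rparr>)"
proof -
  note K = plinthD[OF assms(1)]
  have "derived G K \<lhd> G" "derived G K \<subseteq> K"
    using derived_is_normal derived_incl K by auto
  moreover have "transitive_on \<Omega> (derived G K)"
  proof (rule ccontr)
    assume "\<not> transitive_on \<Omega> (derived G K)"
    moreover have "k \<otimes> l \<otimes> inv k \<otimes> inv l \<in> derived G K" if "k \<in> K" "l \<in> K" for k l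
      using that by (auto simp: derived_def intro: generate.incl)
    ultimately show False
      using commutator_imp_semiregular[OF \<open>derived G K \<lhd> G\<close> _ K(3) K(3,2)] assms(2) by blast
  qed
  ultimately have "derived G K = K"
    using K(4) by blast
  \<comment> \<open>\<open>perfect_group\<close> forms the derived subgroup within \<open>K\<close>
    as a group of its own; \<open>derived_consistent\<close> identifies it with
    \<open>derived G K\<close>.\<close>
  then show ?thesis
    using derived_consistent[OF subset_refl K(3)] subgroup.subgroup_is_group[OF K(3)]
    by (simp add: perfect_group_def is_group)
qed

text \<open>By minimality of \<open>P\<close> it suffices that \<open>P \<inter> (K <#> L)\<close>
  is transitive. Otherwise \<open>K <#> L\<close>, which commutes with \<open>P\<close> modulo it,
  is semiregular, and its transitive subgroups \<open>K\<close> and \<open>L\<close> both equal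
  \<open>K <#> L\<close>.\<close>

lemma plinth_subset_set_mult:
  assumes "plinth \<Omega> S K" "plinth \<Omega> S L" "L \<noteq> K" "plinth \<Omega> S P"
  shows "P \<subseteq> K <#> L"
proof -
  note K = plinthD[OF assms(1)] and L = plinthD[OF assms(2)] and P = plinthD[OF assms(4)]
  have KL: "K <#> L \<lhd> G"
    using set_mult_normal K L by blast
  note sub = normal_imp_subgroup[OF KL]
  have KS: "K \<subseteq> S" "L \<subseteq> S"
    using K L subgroup.subset by fastforce+
  have incl: "K \<subseteq> K <#> L" "L \<subseteq> K <#> L"
    using mono_set_mult[of K K "{\<one>}" L G] mono_set_mult[of "{\<one>}" K L L G]
      subgroup.one_closed[OF K(3)] subgroup.one_closed[OF L(3)] KS coset_mult_one lcos_mult_one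
    by (simp_all add: r_coset_eq_set_mult l_coset_eq_set_mult)
  have PKL: "P \<inter> (K <#> L) \<lhd> G"
    using P KL normal_subgroup_intersect by blast
  have "transitive_on \<Omega> (P \<inter> (K <#> L))"
  proof (rule ccontr)
    assume "\<not> transitive_on \<Omega> (P \<inter> (K <#> L))"
    then have semireg: "semiregular \<Omega> (K <#> L)"
      using commutator_imp_semiregular[OF PKL _ sub P(3,2)] commutator_in_normal_Int[OF KL P(1)]
      by blast
    \<comment> \<open>On an empty set every subgroup is transitive, so failure of transitivity
      supplies a point.\<close>
    have "\<Omega> \<noteq> {}"
      using \<open>\<not> transitive_on \<Omega> (P \<inter> (K <#> L))\<close> normal_imp_subgroup[OF PKL]
      by (auto simp: transitive_on_iff)
    note eq = transitive_subset_semiregular[OF sub semireg _ _ _ this]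
    show False
      using eq[OF K(3) incl(1) K(2)] eq[OF L(3) incl(2) L(2)] assms(3) by simp
  qed
  then show ?thesis
    using P(4)[OF PKL] by blast
qed

section \<open>The quotients of two plinths by their intersection\<close>

lemma plinth_quotient_iso:
  assumes "plinth \<Omega> S K" "plinth \<Omega> S L" "L \<noteq> K"
  shows "G\<lparr>carrier := K\<rparr> Mod (L \<inter> K) \<cong> G\<lparr>carrier := L\<rparr> Mod (L \<inter> K)"
proof -
  define N where "N = L \<inter> K"
  note K = plinthD[OF assms(1)] and L = plinthD[OF assms(2)]
  have N: "N \<lhd> G" "\<not> transitive_on \<Omega> N"
    using plinth_Int[OF assms] by (simp_all add: N_def)
  interpret N: normal N G by (rule N)
  have sr: "semiregular \<Omega> K" "semiregular \<Omega> L"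
    using plinth_semiregular assms by blast+
  interpret NL: normal N "G\<lparr>carrier := L\<rparr>"
    using normal_restrict_supergroup[OF L(3) N(1)] by (simp add: N_def)
  obtain a where a: "a \<in> \<Omega>"
    using N(2) N.subgroup_axioms by (auto simp: transitive_on_iff)
  have KS: "k \<in> S" if "k \<in> K" for k
    using subgroup.mem_carrier[OF K(3) that] by simp
  have LS: "l \<in> S" if "l \<in> L" for l
    using subgroup.mem_carrier[OF L(3) that] by simp
  \<comment> \<open>Such an \<open>l\<close> exists by transitivity of \<open>L\<close> and is
    unique by semiregularity. Requiring \<open>l (k a) = a\<close> makes \<open>f\<close> preserve
    products modulo \<open>N\<close>; requiring \<open>l a = k a\<close> would reverse them.\<close>
  define f where "f k = (SOME l. l \<in> L \<and> l (k a) = a)" for k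
  have f: "f k \<in> L" "f k (k a) = a" if "k \<in> K" for k
  proof -
    have "\<exists>l. l \<in> L \<and> l (k a) = a"
      using L(2,3) a apply_mem[OF KS[OF that] a] by (auto simp: transitive_on_iff)
    then have "f k \<in> L \<and> f k (k a) = a"
      unfolding f_def by (rule someI_ex)
    then show "f k \<in> L" "f k (k a) = a"
      by auto
  qed
  have f_eqI: "f k = l" if "k \<in> K" "l \<in> L" "l (k a) = a" for k l
    using semiregular_eqI[OF L(3) sr(2) f(1)[OF that(1)] that(2) apply_mem[OF KS[OF that(1)] a]]
      f(2)[OF that(1)] that(3) by simp
  have f_mult: "N #> f (k1 \<otimes> k2) = N #> (f k1 \<otimes> f k2)" if k: "k1 \<in> K" "k2 \<in> K" for k1 k2
  proof -
    let ?l1 = "f k1" and ?l2 = "f k2"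
    \<comment> \<open>\<open>n\<close> is the cost of moving \<open>?l2\<close> past
      \<open>k1\<close>, and \<open>m\<close> carries it to the front; the remaining factors
      \<open>?l1 \<otimes> k1\<close> and \<open>?l2 \<otimes> k2\<close> both fix
      \<open>a\<close>.\<close>
    define n where "n = ?l2 \<otimes> k1 \<otimes> inv ?l2 \<otimes> inv k1"
    define m where "m = ?l1 \<otimes> n \<otimes> inv ?l1"
    have n: "n \<in> N"
      using commutator_in_normal_Int[OF L(1) K(1)] f k by (simp add: n_def N_def)
    then have m: "m \<in> N"
      using normal_conj_closed(1)[OF N(1)] f(1)[OF k(1)] LS by (simp add: m_def)
    note mem = f(1)[OF k(1), THEN LS] f(1)[OF k(2), THEN LS] k[THEN KS]
      N.mem_carrier[OF n, simplified] N.mem_carrier[OF m, simplified]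
    have "?l1 \<otimes> ?l2 \<otimes> (k1 \<otimes> k2) = m \<otimes> (?l1 \<otimes> k1) \<otimes> (?l2 \<otimes> k2)"
      using mem by (simp add: m_def n_def m_assoc inv_mult_cancel)
    then have "(?l1 \<otimes> ?l2) ((k1 \<otimes> k2) a) = (m \<otimes> (?l1 \<otimes> k1) \<otimes> (?l2 \<otimes> k2)) a"
      using mem a by (metis S_closed(1) mult_apply)
    also have "\<dots> = m a"
      using mem a f k by (simp add: mult_apply apply_mem)
    finally have "(inv m \<otimes> (?l1 \<otimes> ?l2)) ((k1 \<otimes> k2) a) = a"
      using mem a by (simp add: mult_apply[of "inv m"] apply_mem inv_apply_apply)
    moreover have "inv m \<otimes> (?l1 \<otimes> ?l2) \<in> L"
      using f(1) k m L(3) by (auto simp: N_def intro!: subgroup.m_closed subgroup.m_inv_closed)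
    \<comment> \<open>Uniqueness determines the value of \<open>f\<close>; the factor
      \<open>inv m\<close> is then absorbed by the coset of \<open>N\<close>.\<close>
    ultimately have "f (k1 \<otimes> k2) = inv m \<otimes> (?l1 \<otimes> ?l2)"
      using f_eqI k subgroup.m_closed[OF K(3)] by blast
    then show ?thesis
      using mem N.m_inv_closed[OF m] coset_join2[OF _ N.subgroup_axioms, of "inv m"] N.subset
      by (simp flip: coset_mult_assoc)
  qed
  let ?h = "\<lambda>k. N #> f k"
  have "?h \<in> hom (G\<lparr>carrier := K\<rparr>) (G\<lparr>carrier := L\<rparr> Mod N)"
    using f(1) f_mult N.rcos_sum LS by (auto simp: hom_def carrier_FactGroup)
  then interpret h: group_hom "G\<lparr>carrier := K\<rparr>" "G\<lparr>carrier := L\<rparr> Mod N" ?h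
    using NL.factorgroup_is_group subgroup.subgroup_is_group[OF K(3) is_group]
    by (simp add: group_hom_def group_hom_axioms_def)
  \<comment> \<open>This makes the kernel exactly \<open>N\<close>: if either of \<open>k\<close>
    and \<open>f k\<close> lies in \<open>N\<close>, then both plinths contain its inverse, and
    semiregularity identifies that inverse with the other element.\<close>
  have f_mem_iff: "f k \<in> N \<longleftrightarrow> k \<in> N" if k: "k \<in> K" for k
  proof
    assume "f k \<in> N"
    then have "inv (f k) \<in> N"
      by simp
    moreover from this have "inv (f k) \<in> K"
      by (simp add: N_def)
    moreover have "(inv (f k)) a = k a"
      using inv_apply_apply[OF LS[OF f(1)] apply_mem[OF KS a]] k f(2) by metis
    ultimately show "k \<in> N"
      using semiregular_eqI[OF K(3) sr(1) _ k a] by metis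
  next
    assume "k \<in> N"
    then have "inv k \<in> N"
      by simp
    moreover have "f k = inv k"
      using calculation f_eqI[OF k] inv_apply_apply[OF KS[OF k] a] by (simp add: N_def)
    ultimately show "f k \<in> N"
      by simp
  qed
  have "N #> f k = N \<longleftrightarrow> k \<in> N" if "k \<in> K" for k
    using coset_join1[OF _ _ N.subgroup_axioms] coset_join2[OF _ N.subgroup_axioms]
      LS[OF f(1)[OF that]] f_mem_iff[OF that] by auto
  then have "kernel (G\<lparr>carrier := K\<rparr>) (G\<lparr>carrier := L\<rparr> Mod N) ?h = {k \<in> K. k \<in> N}"
    by (auto simp: kernel_def)
  also have "\<dots> = N"
    by (auto simp: N_def)
  finally have "kernel (G\<lparr>carrier := K\<rparr>) (G\<lparr>carrier := L\<rparr> Mod N) ?h = N" .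
  moreover have "?h ` carrier (G\<lparr>carrier := K\<rparr>) = carrier (G\<lparr>carrier := L\<rparr> Mod N)"
  proof
    show "carrier (G\<lparr>carrier := L\<rparr> Mod N) \<subseteq> ?h ` carrier (G\<lparr>carrier := K\<rparr>)"
    proof
      fix A assume "A \<in> carrier (G\<lparr>carrier := L\<rparr> Mod N)"
      then obtain l where l: "l \<in> L" "A = N #> l"
        by (auto simp: carrier_FactGroup)
      have "(inv l) a \<in> \<Omega>"
        using apply_mem[OF _ a] inv_closed LS[OF l(1)] by simp
      then obtain k where k: "k \<in> K" "k a = (inv l) a"
        using K(2,3) a by (auto simp: transitive_on_iff)
      then have "f k = l"
        using f_eqI[OF _ l(1)] apply_inv_apply[OF LS[OF l(1)] a] by simp
      then show "A \<in> ?h ` carrier (G\<lparr>carrier := K\<rparr>)"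
        using l k by auto
    qed
  qed (use h.hom_closed in auto)
  ultimately show ?thesis
    using h.FactGroup_iso by (simp add: N_def)
qed

text \<open>A proper \<open>H\<close> is intransitive by minimality of \<open>K\<close>, so only the
  identity of its orbit kernel has a fixed point. For \<open>l\<close> in \<open>L\<close> undoing
  \<open>h\<close> at \<open>a\<close>, this applies to \<open>l \<otimes> h\<close> and gives
  \<open>h = inv l\<close>, an element of \<open>L\<close>.\<close>

lemma normal_between_plinth_Int:
  assumes "plinth \<Omega> S K" "plinth \<Omega> S L" "L \<noteq> K"
    and "H \<lhd> G" "L \<inter> K \<subseteq> H" "H \<subseteq> K"
  shows "H = L \<inter> K \<or> H = K"
proof (rule disjCI)
  note K = plinthD[OF assms(1)] and L = plinthD[OF assms(2)]
  interpret H: normal H G by fact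
  assume "H \<noteq> K"
  then have H: "\<not> transitive_on \<Omega> H"
    using K(4) assms by blast
  obtain a where a: "a \<in> \<Omega>"
    using H H.subgroup_axioms by (auto simp: transitive_on_iff)
  have KS: "k \<in> S" if "k \<in> K" for k
    using subgroup.mem_carrier[OF K(3) that] by simp
  have "h \<in> L \<inter> K" if h: "h \<in> H" for h
  proof -
    have hS: "h \<in> S"
      using H.mem_carrier[OF h] by simp
    obtain l where l: "l \<in> L" "l (h a) = a"
      using L(2,3) a apply_mem[OF hS a] by (auto simp: transitive_on_iff)
    have lS: "l \<in> S"
      using l subgroup.mem_carrier[OF L(3)] by simp
    \<comment> \<open>\<open>l\<close> commutes with \<open>K\<close> modulo \<open>H\<close> and maps \<open>a\<close> into its \<open>H\<close>-orbit,
      so it fixes every \<open>H\<close>-orbit.\<close>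
    have "\<exists>n\<in>H. (l \<otimes> h) x = n x" if x: "x \<in> \<Omega>" for x
    proof -
      obtain k where k: "k \<in> K" "k a = x"
        using K(2,3) a x by (auto simp: transitive_on_iff)
      define m where "m = h \<otimes> k"
      have m: "m \<in> K"
        using h k assms(6) subgroup.m_closed[OF K(3)] by (auto simp: m_def)
      \<comment> \<open>\<open>n\<close> exchanges \<open>l\<close> and \<open>m\<close>, while
        \<open>q\<close>, a conjugate of \<open>inv h\<close>, pays for an extra \<open>h\<close> to
        the right of \<open>l\<close>; thus \<open>l \<otimes> h\<close> acts first and fixes
        \<open>a\<close>.\<close>
      define n where "n = l \<otimes> m \<otimes> inv l \<otimes> inv m"
      define q where "q = m \<otimes> (l \<otimes> inv h \<otimes> inv l) \<otimes> inv m"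
      have "n \<in> H"
        using commutator_in_normal_Int[OF L(1) K(1) l(1) m] assms(5) by (auto simp: n_def)
      moreover have "q \<in> H"
        using normal_conj_closed(1)[OF assms(4)] m h KS lS H.m_inv_closed by (simp add: q_def)
      ultimately have nqh: "n \<otimes> q \<otimes> h \<in> H"
        using h by simp
      note mem = lS hS KS[OF k(1)] H.mem_carrier[OF nqh, simplified]
      have "(l \<otimes> h) x = (l \<otimes> (h \<otimes> k)) a"
        using mem a by (simp add: mult_apply apply_mem flip: k(2))
      also have "l \<otimes> (h \<otimes> k) = (n \<otimes> q \<otimes> h) \<otimes> k \<otimes> (l \<otimes> h)"
        using mem by (simp add: n_def q_def m_def m_assoc inv_mult_cancel inv_mult_group)
      also have "\<dots> a = (n \<otimes> q \<otimes> h) x"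
        using mem a k(2) l(2) by (simp add: mult_apply apply_mem)
      finally show ?thesis
        using nqh by blast
    qed
    then have "l \<otimes> h = \<one>"
      using orbit_kernel_fixed_point[of H "l \<otimes> h" a, OF assms(4) H _ a] lS hS a l(2)
      by (simp add: orbit_kernel_def mult_apply)
    then have "h = inv l"
      using lS hS inv_equality[of h l] by (metis carrier_G inv_inv inv_equality)
    then show ?thesis
      using l h assms(6) subgroup.m_inv_closed[OF L(3)] by auto
  qed
  then show "H = L \<inter> K"
    using assms(5) by blast
qed

text \<open>Conjugation by any element of \<open>G\<close> induces an automorphism of the quotient,
  so a characteristic subgroup has a preimage normal in \<open>G\<close>, and
  \<open>normal_between_plinth_Int\<close> leaves only the two extremes.\<close>

lemma plinth_quotient_characteristically_simple:
  assumes "plinth \<Omega> S K" "plinth \<Omega> S L" "L \<noteq> K"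
  shows "characteristically_simple (G\<lparr>carrier := K\<rparr> Mod (L \<inter> K))"
proof -
  define N where "N = L \<inter> K"
  let ?Q = "G\<lparr>carrier := K\<rparr> Mod N"
  note K = plinthD[OF assms(1)] and L = plinthD[OF assms(2)]
  have N: "N \<lhd> G" "\<not> transitive_on \<Omega> N"
    using plinth_Int[OF assms] by (simp_all add: N_def)
  interpret N: normal N G by (rule N)
  interpret NK: normal N "G\<lparr>carrier := K\<rparr>"
    using normal_restrict_supergroup[OF K(3) N(1)] by (simp add: N_def)
  interpret Q: group ?Q
    by (rule NK.factorgroup_is_group)
  have KS: "k \<in> S" if "k \<in> K" for k
    using subgroup.mem_carrier[OF K(3) that] by simp
  have coset_eq_iff: "N #> k = N \<longleftrightarrow> k \<in> N" if "k \<in> K" for k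
    using coset_join1[OF _ _ N.subgroup_axioms] coset_join2[OF _ N.subgroup_axioms] KS[OF that]
    by auto
  have "H = {N} \<or> H = carrier ?Q" if H: "characteristic_subgroup H ?Q" for H
  proof -
    have subH: "subgroup H ?Q"
      using H by (simp add: characteristic_subgroup_def)
    define H' where "H' = {k \<in> K. N #> k \<in> H}"
    \<comment> \<open>\<open>H\<close> is recovered from its full preimage \<open>H'\<close> in
      \<open>K\<close>, so it suffices to determine \<open>H'\<close>.\<close>
    have H_eq: "H = (\<lambda>k. N #> k) ` H'"
      using subgroup.subset[OF subH] by (auto simp: H'_def carrier_FactGroup)
    have "subgroup H' G"
    proof (rule subgroupI)
      show "H' \<subseteq> carrier G"
        using KS by (auto simp: H'_def)
      have "\<one> \<in> H'"
        using subgroup.one_closed[OF subH] subgroup.one_closed[OF K(3)] coset_mult_one N.subset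
        by (simp add: H'_def)
      then show "H' \<noteq> {}"
        by blast
    next
      fix k assume k: "k \<in> H'"
      then have "inv\<^bsub>?Q\<^esub> (N #> k) \<in> H"
        using subgroup.m_inv_closed[OF subH] by (simp add: H'_def)
      moreover have "inv\<^bsub>?Q\<^esub> (N #> k) = N #> inv k"
        using k KS N.rcos_sum[of "inv k" k] coset_mult_one[OF N.subset] subgroup.m_inv_closed[OF K(3)]
        by (intro Q.inv_equality) (auto simp: H'_def carrier_FactGroup)
      ultimately show "inv k \<in> H'"
        using k subgroup.m_inv_closed[OF K(3)] by (simp add: H'_def)
    next
      fix j k assume "j \<in> H'" "k \<in> H'"
      then show "j \<otimes> k \<in> H'"
        using subgroup.m_closed[OF subH, of "N #> j" "N #> k"] subgroup.m_closed[OF K(3)] N.rcos_sum KS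
        by (simp add: H'_def)
    qed
    moreover have "g \<otimes> k \<otimes> inv g \<in> H'" if "g \<in> S" "k \<in> H'" for g k
    proof -
      let ?c = "image (\<lambda>x. g \<otimes> x \<otimes> inv g)"
      have "?c ` H = H"
        using H conj_iso_FactGroup[OF K(1) N(1)] that by (simp add: characteristic_subgroup_def)
      then have "?c (N #> k) \<in> H"
        using that by (auto simp: H'_def)
      then show ?thesis
        using that conj_coset[OF N(1)] KS normal_conj_closed(1)[OF K(1)] by (simp add: H'_def)
    qed
    ultimately have "H' \<lhd> G"
      by (simp add: normal_inv_iff)
    moreover have "N \<subseteq> H'"
    proof
      fix k assume "k \<in> N"
      then show "k \<in> H'"
        using coset_eq_iff[of k] subgroup.one_closed[OF subH] by (simp add: H'_def) (simp add: N_def)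
    qed
    moreover have "H' \<subseteq> K"
      by (auto simp: H'_def)
    ultimately consider "H' = N" | "H' = K"
      using normal_between_plinth_Int[OF assms, of H'] by (auto simp: N_def)
    then show ?thesis
    proof cases
      case 1
      then have "H = (\<lambda>k. N) ` N"
        using H_eq coset_eq_iff by (auto simp: N_def)
      then show ?thesis
        using image_constant[OF N.one_closed, of N] by simp
    next
      case 2
      then show ?thesis
        using H_eq by (simp add: carrier_FactGroup)
    qed
  qed
  \<comment> \<open>Characteristic simplicity excludes the trivial group; the quotient is nontrivial
    because \<open>K\<close> is transitive and \<open>N\<close> is not.\<close>
  moreover have "carrier ?Q \<noteq> {N}"
  proof
    assume "carrier ?Q = {N}"
    then have "N #> k = N" if "k \<in> K" for k
      using that by (auto simp: carrier_FactGroup)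
    then have "K \<subseteq> N"
      using coset_eq_iff by blast
    then have "N = K"
      by (auto simp: N_def)
    then show False
      using N(2) K(2) by simp
  qed
  ultimately show ?thesis
    using NK.factorgroup_is_group by (simp add: characteristically_simple_def N_def)
qed

end

theorem theorem1p1:
  fixes \<Omega> :: "'a set" and G K :: "('a \<Rightarrow> 'a) set"
  assumes "subgroup G (BijGroup \<Omega>)"
    and "semiprimitive \<Omega> G"
    and "plinth \<Omega> G K"
  shows "(\<not> regular \<Omega> K \<longrightarrow>
            perfect_group (perm_group \<Omega> K) \<and> (\<forall>L. plinth \<Omega> G L \<longrightarrow> L = K)) \<and>
         (\<forall>L. plinth \<Omega> G L \<and> L \<noteq> K \<longrightarrow>
            perm_group \<Omega> K Mod (L \<inter> K) \<cong> perm_group \<Omega> L Mod (L \<inter> K) \<and>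
            characteristically_simple (perm_group \<Omega> K Mod (L \<inter> K)) \<and>
            (\<forall>P. plinth \<Omega> G P \<longrightarrow> P \<subseteq> K <#>\<^bsub>BijGroup \<Omega>\<^esub> L))"
proof -
  interpret semiprimitive_group \<Omega> G "perm_group \<Omega> G"
    using assms by (intro semiprimitive_group.intro refl)
  have "perfect_group (perm_group \<Omega> K) \<and> (\<forall>L. plinth \<Omega> G L \<longrightarrow> L = K)" if "\<not> regular \<Omega> K"
  proof -
    \<comment> \<open>A plinth is transitive, so being non-regular means not being
      semiregular.\<close>
    have nsr: "\<not> semiregular \<Omega> K"
      using that plinthD(2)[OF assms(3)] by (simp add: regular_def)
    show ?thesis
      using plinth_perfect[OF assms(3) nsr] plinth_semiregular[OF assms(3)] nsr by auto
  qed
  \<comment> \<open>Overwriting the carrier of \<open>perm_group \<Omega> G\<close> by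
    \<open>K\<close> gives \<open>perm_group \<Omega> K\<close>, and products of sets depend only on
    the multiplication of \<open>BijGroup \<Omega>\<close>.\<close>
  moreover have "perm_group \<Omega> K Mod (L \<inter> K) \<cong> perm_group \<Omega> L Mod (L \<inter> K) \<and>
      characteristically_simple (perm_group \<Omega> K Mod (L \<inter> K)) \<and>
      (\<forall>P. plinth \<Omega> G P \<longrightarrow> P \<subseteq> K <#>\<^bsub>BijGroup \<Omega>\<^esub> L)"
    if "plinth \<Omega> G L" "L \<noteq> K" for L
    using plinth_quotient_iso[OF assms(3) that] plinth_subset_set_mult[OF assms(3) that]
      plinth_quotient_characteristically_simple[OF assms(3) that]
    by simp
  ultimately show ?thesis
    by blast
qed

end
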